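(* (i) The quadruple $(\omega,I_1,I_2,I_3)$ is a hyper anti-Kähler structure on the pre-Lie algebra $\mathfrak g$ if and only if $(\mathscr B_1,\mathscr B_2,\mathscr B_3)$ is an $\varepsilon$-hyper Hessian structure with $\varepsilon=(-1,-1,-1)$, where $\mathscr B_i$ are given by $\mathscr B_i(x,y)=\omega(I_i(x),y)$ for all $x,y\in\mathfrak g$ and $i=1,2,3$. (ii) The quadruple $(\omega,I_1,I_2,I_3)$ is a para-hyper anti-Kähler structure on the pre-Lie algebra $\mathfrak g$ if and only if $(\mathscr B_1,\mathscr B_2,\mathscr B_3)$ is an $\varepsilon$-hyper Hessian structure with $\varepsilon=(1,1,-1)$, where $\mathscr B_i$ are given by $\mathscr B_i(x,y)=\omega(I_i(x),y)$ for all $x,y\in\mathfrak g$ and $i=1,2,3$.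
   Context: In a quadruple $(\omega,I_1,I_2,I_3)$, $\omega$ is a bilinear form on $\mathfrak g$ and $I_1,I_2,I_3:\mathfrak g\to\mathfrak g$ are linear maps. A pre-Lie algebra is a vector space $\mathfrak g$ with a bilinear product $\cdot$ satisfying $(x\cdot y)\cdot z-x\cdot(y\cdot z)=(y\cdot x)\cdot z-y\cdot(x\cdot z)$. Its sub-adjacent Lie algebra $\mathfrak g^c$ is $\mathfrak g$ with bracket $[x,y]=x\cdot y-y\cdot x$. The coregular representation $(\mathfrak g^*;L^* )$ of $\mathfrak g^c$ is given by $\langle L^*_x\xi,y\rangle=-\langle\xi,x\cdot y\rangle$. A Hessian structure on $(\mathfrak g,\cdot)$ is a nondegenerate symmetric bilinear form $\mathscr B:\mathfrak g\otimes\mathfrak g\to\mathbb R$ with $\mathscr B(x\cdot y,z)-\mathscr B(x,y\cdot z)=\mathscr B(y\cdot x,z)-\mathscr B(y,x\cdot z)$ for all $x,y,z\in\mathfrak g$; define $\mathscr B^\natural:\mathfrak g\to\mathfrak g^*$ by $\langle\mathscr B^\natural(x),y\rangle=\mathscr B(x,y)$. For a Lie algebra $\mathfrak h$ with representation $(V;\rho)$, a relative differential operator is a linear map $d:\mathfrak h\to V$ with $d[x,y]=\rho(x)d(y)-\rho(y)d(x)$ for all $x,y\in\mathfrak h$. Invertible relative differential operators $d_1,d_2,d_3$ with respect to $(V;\rho)$ form an $\varepsilon=(\varepsilon_1,\varepsilon_2,\varepsilon_3)$-hyper relative differential operator, $\varepsilon_i=\pm1$, if $(d_{i-1}^{-1}\circ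 d_{i+1})^2=\varepsilon_i\,\mathrm{Id}_{\mathfrak h}$ for $i=1,2,3$ (indices mod 3). An $\varepsilon$-hyper Hessian structure on $\mathfrak g$ is a triple $(\mathscr B_1,\mathscr B_2,\mathscr B_3)$ of Hessian structures on $\mathfrak g$ such that $(\mathscr B_1^\natural,\mathscr B_2^\natural,\mathscr B_3^\natural)$ is an $\varepsilon$-hyper relative differential operator on $\mathfrak g^c$ with respect to $(\mathfrak g^*;L^* )$. A Nijenhuis operator on a Lie algebra is a linear endomorphism $N$ with $[Nx,Ny]=N([Nx,y]+[x,Ny]-N[x,y])$ for all $x,y$; it is a complex structure if $N^2=-\mathrm{Id}$ and a para-complex structure if $N^2=\mathrm{Id}$. An anti-Hermitian structure on a Lie algebra is a pair $(\omega,I)$ with $\omega$ a nondegenerate skew-symmetric bilinear form and $I$ a complex structure with $\omega(I(x),I(y))=\omega(x,y)$ for all $x,y$; a para-anti-Hermitian structure is a pair $(\omega,I)$ with $\omega$ a nondegenerate skew-symmetric bilinear form and $I$ a para-complex structure with $\omega(I(x),I(y))=-\omega(x,y)$ for all $x,y$. A hyper anti-Kähler (resp. para-hyper anti-Kähler) structure on the pre-Lie algebra $\mathfrak g$ is a quadruple $(\omega,I_1,I_2,I_3)$ such that $(\omega,I_1)$ and $(\omega,I_2)$ are anti-Hermitian (resp. para-anti-Hermitian) structures on $\mathfrak g^c$, $I_3=I_1I_2$, $I_1I_2=-I_2I_1$, and the bilinear forms $\mathscr B_i(x,y)=\omega(I_i(x),y)$, $i=1,2,3$, are Hessian structures on $\mathfrak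 g$.
   Formalization: I_3 = I_1 I_2 is assumed throughout: without it the "if" parts fail, as (ω/2, 2I_1, 2I_2, 2I_3) gives the same forms B_i as (ω, I_1, I_2, I_3). Nondegenerate means that the induced map to the dual is bijective. *)

theory Defs
  imports "HOL-Analysis.Linear_Algebra"
begin

text \<open>
  A real vector space \<open>\<g>\<close> is the universe of a type of class \<^class>\<open>real_vector\<close>; no dimension is
  fixed.  Its algebraic dual \<open>\<g>*\<close> is the following type.
\<close>

typedef (overloaded) 'a dual = "{f :: 'a::real_vector \<Rightarrow> real. linear f}"
  morphisms dual_apply Abs_dual
  by (rule exI[of _ "\<lambda>_. 0"]) (simp add: linear_zero)

setup_lifting type_definition_dual

instantiation dual :: (real_vector) real_vector
begin

lift_definition zero_dual :: "'a dual" is "\<lambda>_. 0" by (rule linear_zero)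
lift_definition plus_dual :: "'a dual \<Rightarrow> 'a dual \<Rightarrow> 'a dual" is "\<lambda>f g x. f x + g x"
  by (rule linear_compose_add)
lift_definition minus_dual :: "'a dual \<Rightarrow> 'a dual \<Rightarrow> 'a dual" is "\<lambda>f g x. f x - g x"
  by (rule linear_compose_sub)
lift_definition uminus_dual :: "'a dual \<Rightarrow> 'a dual" is "\<lambda>f x. - f x"
  by (rule linear_compose_neg)
lift_definition scaleR_dual :: "real \<Rightarrow> 'a dual \<Rightarrow> 'a dual" is "\<lambda>c f x. c *\<^sub>R f x"
  by (rule linear_compose_scale_right)

instance
  by standard (transfer; simp add: fun_eq_iff algebra_simps)+

end

definition lie_algebra :: "('a::real_vector \<Rightarrow> 'a \<Rightarrow> 'a) \<Rightarrow> bool" where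
  "lie_algebra br \<longleftrightarrow> bilinear br \<and> (\<forall>x. br x x = 0) \<and>
     (\<forall>x y z. br x (br y z) + br y (br z x) + br z (br x y) = 0)"

definition lie_representation ::
    "('a::real_vector \<Rightarrow> 'a \<Rightarrow> 'a) \<Rightarrow> ('a \<Rightarrow> 'v::real_vector \<Rightarrow> 'v) \<Rightarrow> bool" where
  "lie_representation br \<rho> \<longleftrightarrow> bilinear \<rho> \<and>
     (\<forall>x y v. \<rho> (br x y) v = \<rho> x (\<rho> y v) - \<rho> y (\<rho> x v))"

definition pre_lie_algebra :: "('a::real_vector \<Rightarrow> 'a \<Rightarrow> 'a) \<Rightarrow> bool" where
  "pre_lie_algebra p \<longleftrightarrow> bilinear p \<and>
     (\<forall>x y z. p (p x y) z - p x (p y z) = p (p y x) z - p y (p x z))"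

definition sub_adjacent :: "('a::real_vector \<Rightarrow> 'a \<Rightarrow> 'a) \<Rightarrow> 'a \<Rightarrow> 'a \<Rightarrow> 'a" where
  "sub_adjacent p x y = p x y - p y x"

text \<open>The terms under \<^const>\<open>Abs_dual\<close> below are linear whenever \<open>p\<close> and \<open>B\<close> are bilinear.\<close>

definition coregular :: "('a::real_vector \<Rightarrow> 'a \<Rightarrow> 'a) \<Rightarrow> 'a \<Rightarrow> 'a dual \<Rightarrow> 'a dual" where
  "coregular p x \<xi> = Abs_dual (\<lambda>y. - dual_apply \<xi> (p x y))"

definition natural_map :: "('a::real_vector \<Rightarrow> 'a \<Rightarrow> real) \<Rightarrow> 'a \<Rightarrow> 'a dual" where
  "natural_map B x = Abs_dual (B x)"

text \<open>
  Nondegeneracy means that the induced map \<open>\<g> \<rightarrow> \<g>*\<close> is an isomorphism.  In finite dimension this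
  is the triviality of the radical, see \<open>nondegenerate_iff_radical\<close> below.
\<close>

definition nondegenerate :: "('a::real_vector \<Rightarrow> 'a \<Rightarrow> real) \<Rightarrow> bool" where
  "nondegenerate B \<longleftrightarrow> bij (natural_map B)"

definition hessian_structure ::
    "('a::real_vector \<Rightarrow> 'a \<Rightarrow> 'a) \<Rightarrow> ('a \<Rightarrow> 'a \<Rightarrow> real) \<Rightarrow> bool" where
  "hessian_structure p B \<longleftrightarrow>
     bilinear B \<and> nondegenerate B \<and> (\<forall>x y. B x y = B y x) \<and>
     (\<forall>x y z. B (p x y) z - B x (p y z) = B (p y x) z - B y (p x z))"

definition relative_differential_operator ::
    "('a::real_vector \<Rightarrow> 'a \<Rightarrow> 'a) \<Rightarrow> ('a \<Rightarrow> 'v::real_vector \<Rightarrow> 'v) \<Rightarrow> ('a \<Rightarrow> 'v) \<Rightarrow> bool" where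
  "relative_differential_operator br \<rho> d \<longleftrightarrow>
     lie_algebra br \<and> lie_representation br \<rho> \<and> linear d \<and>
     (\<forall>x y. d (br x y) = \<rho> x (d y) - \<rho> y (d x))"

text \<open>
  The last three conditions are \<open>(d\<^bsub>i-1\<^esub>\<^sup>-\<^sup>1 \<circ> d\<^bsub>i+1\<^esub>)\<^sup>2 = \<epsilon>\<^sub>i Id\<close> for \<open>i = 1, 2, 3\<close>, with indices mod 3.
\<close>

definition hyper_relative_differential_operator ::
    "('a::real_vector \<Rightarrow> 'a \<Rightarrow> 'a) \<Rightarrow> ('a \<Rightarrow> 'v::real_vector \<Rightarrow> 'v) \<Rightarrow> real \<times> real \<times> real \<Rightarrow>
     ('a \<Rightarrow> 'v) \<Rightarrow> ('a \<Rightarrow> 'v) \<Rightarrow> ('a \<Rightarrow> 'v) \<Rightarrow> bool" where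
  "hyper_relative_differential_operator br \<rho> = (\<lambda>(\<epsilon>1, \<epsilon>2, \<epsilon>3) d1 d2 d3.
     \<epsilon>1 \<in> {1, -1} \<and> \<epsilon>2 \<in> {1, -1} \<and> \<epsilon>3 \<in> {1, -1} \<and>
     (\<forall>d \<in> {d1, d2, d3}. relative_differential_operator br \<rho> d \<and> bij d) \<and>
     (\<forall>x. ((inv d3 \<circ> d2) ^^ 2) x = \<epsilon>1 *\<^sub>R x) \<and>
     (\<forall>x. ((inv d1 \<circ> d3) ^^ 2) x = \<epsilon>2 *\<^sub>R x) \<and>
     (\<forall>x. ((inv d2 \<circ> d1) ^^ 2) x = \<epsilon>3 *\<^sub>R x))"

definition hyper_hessian_structure ::
    "('a::real_vector \<Rightarrow> 'a \<Rightarrow> 'a) \<Rightarrow> real \<times> real \<times> real \<Rightarrow>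
     ('a \<Rightarrow> 'a \<Rightarrow> real) \<Rightarrow> ('a \<Rightarrow> 'a \<Rightarrow> real) \<Rightarrow> ('a \<Rightarrow> 'a \<Rightarrow> real) \<Rightarrow> bool" where
  "hyper_hessian_structure p \<epsilon> B1 B2 B3 \<longleftrightarrow>
     hessian_structure p B1 \<and> hessian_structure p B2 \<and> hessian_structure p B3 \<and>
     hyper_relative_differential_operator (sub_adjacent p) (coregular p) \<epsilon>
       (natural_map B1) (natural_map B2) (natural_map B3)"

definition nijenhuis :: "('a::real_vector \<Rightarrow> 'a \<Rightarrow> 'a) \<Rightarrow> ('a \<Rightarrow> 'a) \<Rightarrow> bool" where
  "nijenhuis br N \<longleftrightarrow> linear N \<and>
     (\<forall>x y. br (N x) (N y) = N (br (N x) y + br x (N y) - N (br x y)))"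

definition complex_structure :: "('a::real_vector \<Rightarrow> 'a \<Rightarrow> 'a) \<Rightarrow> ('a \<Rightarrow> 'a) \<Rightarrow> bool" where
  "complex_structure br N \<longleftrightarrow> nijenhuis br N \<and> (\<forall>x. N (N x) = - x)"

definition para_complex_structure :: "('a::real_vector \<Rightarrow> 'a \<Rightarrow> 'a) \<Rightarrow> ('a \<Rightarrow> 'a) \<Rightarrow> bool" where
  "para_complex_structure br N \<longleftrightarrow> nijenhuis br N \<and> (\<forall>x. N (N x) = x)"

definition anti_hermitian ::
    "('a::real_vector \<Rightarrow> 'a \<Rightarrow> 'a) \<Rightarrow> ('a \<Rightarrow> 'a \<Rightarrow> real) \<Rightarrow> ('a \<Rightarrow> 'a) \<Rightarrow> bool" where
  "anti_hermitian br \<omega> I \<longleftrightarrow>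
     bilinear \<omega> \<and> nondegenerate \<omega> \<and> (\<forall>x y. \<omega> x y = - \<omega> y x) \<and>
     complex_structure br I \<and> (\<forall>x y. \<omega> (I x) (I y) = \<omega> x y)"

definition para_anti_hermitian ::
    "('a::real_vector \<Rightarrow> 'a \<Rightarrow> 'a) \<Rightarrow> ('a \<Rightarrow> 'a \<Rightarrow> real) \<Rightarrow> ('a \<Rightarrow> 'a) \<Rightarrow> bool" where
  "para_anti_hermitian br \<omega> I \<longleftrightarrow>
     bilinear \<omega> \<and> nondegenerate \<omega> \<and> (\<forall>x y. \<omega> x y = - \<omega> y x) \<and>
     para_complex_structure br I \<and> (\<forall>x y. \<omega> (I x) (I y) = - \<omega> x y)"

definition hyper_anti_kaehler ::
    "('a::real_vector \<Rightarrow> 'a \<Rightarrow> 'a) \<Rightarrow> ('a \<Rightarrow> 'a \<Rightarrow> real) \<Rightarrow>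
     ('a \<Rightarrow> 'a) \<Rightarrow> ('a \<Rightarrow> 'a) \<Rightarrow> ('a \<Rightarrow> 'a) \<Rightarrow> bool" where
  "hyper_anti_kaehler p \<omega> I1 I2 I3 \<longleftrightarrow>
     anti_hermitian (sub_adjacent p) \<omega> I1 \<and> anti_hermitian (sub_adjacent p) \<omega> I2 \<and>
     I3 = I1 \<circ> I2 \<and> (\<forall>x. I1 (I2 x) = - I2 (I1 x)) \<and>
     (\<forall>I \<in> {I1, I2, I3}. hessian_structure p (\<lambda>x y. \<omega> (I x) y))"

definition para_hyper_anti_kaehler ::
    "('a::real_vector \<Rightarrow> 'a \<Rightarrow> 'a) \<Rightarrow> ('a \<Rightarrow> 'a \<Rightarrow> real) \<Rightarrow>
     ('a \<Rightarrow> 'a) \<Rightarrow> ('a \<Rightarrow> 'a) \<Rightarrow> ('a \<Rightarrow> 'a) \<Rightarrow> bool" where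
  "para_hyper_anti_kaehler p \<omega> I1 I2 I3 \<longleftrightarrow>
     para_anti_hermitian (sub_adjacent p) \<omega> I1 \<and> para_anti_hermitian (sub_adjacent p) \<omega> I2 \<and>
     I3 = I1 \<circ> I2 \<and> (\<forall>x. I1 (I2 x) = - I2 (I1 x)) \<and>
     (\<forall>I \<in> {I1, I2, I3}. hessian_structure p (\<lambda>x y. \<omega> (I x) y))"

lemma dual_apply_natural_map:
  assumes "bilinear B"
  shows "dual_apply (natural_map B x) y = B x y"
  using assms by (simp add: natural_map_def bilinear_def Abs_dual_inverse)

lemma dual_apply_coregular:
  assumes "bilinear p"
  shows "dual_apply (coregular p x \<xi>) y = - dual_apply \<xi> (p x y)"
proof -
  have "linear (p x)" "linear (dual_apply \<xi>)"
    using assms dual_apply[of \<xi>] by (auto simp: bilinear_def)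
  then have "linear (\<lambda>y. - dual_apply \<xi> (p x y))"
    using linear_compose_neg[OF linear_compose[of "p x" "dual_apply \<xi>"]] by (simp add: o_def)
  then show ?thesis by (simp add: coregular_def Abs_dual_inverse)
qed

lemma dual_eq_iff: "f = g \<longleftrightarrow> (\<forall>x. dual_apply f x = dual_apply g x)"
  by (simp add: dual_apply_inject[symmetric] fun_eq_iff)

lemma lie_algebra_sub_adjacent:
  assumes "pre_lie_algebra p"
  shows "lie_algebra (sub_adjacent p)"
proof -
  have bl: "bilinear p" and pl: "\<And>x y z. p (p x y) z - p x (p y z) = p (p y x) z - p y (p x z)"
    using assms by (auto simp: pre_lie_algebra_def)
  have "bilinear (sub_adjacent p)"
    using bl by (auto simp: bilinear_def sub_adjacent_def intro!: linear_compose_sub)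
  moreover have "sub_adjacent p x (sub_adjacent p y z) + sub_adjacent p y (sub_adjacent p z x) +
      sub_adjacent p z (sub_adjacent p x y) = 0" for x y z
  proof -
    define A where "A x y z = p (p x y) z - p x (p y z) - (p (p y x) z - p y (p x z))" for x y z
    have "sub_adjacent p x (sub_adjacent p y z) + sub_adjacent p y (sub_adjacent p z x) +
        sub_adjacent p z (sub_adjacent p x y) = - (A x y z + A y z x + A z x y)"
      by (simp add: A_def sub_adjacent_def bilinear_lsub[OF bl] bilinear_rsub[OF bl] algebra_simps)
    moreover have "A x y z = 0" for x y z
      by (simp only: A_def pl diff_self)
    ultimately show ?thesis by simp
  qed
  ultimately show ?thesis by (simp add: lie_algebra_def sub_adjacent_def)
qed

lemma lie_representation_coregular:
  assumes "pre_lie_algebra p"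
  shows "lie_representation (sub_adjacent p) (coregular p)"
proof -
  have bl: "bilinear p" and pl: "\<And>x y z. p (p x y) z - p x (p y z) = p (p y x) z - p y (p x z)"
    using assms by (auto simp: pre_lie_algebra_def)
  note lin = dual_apply[simplified]
  have "bilinear (coregular p)"
    unfolding bilinear_def
    by (auto intro!: linearI
        simp: dual_eq_iff dual_apply_coregular[OF bl] plus_dual.rep_eq scaleR_dual.rep_eq
          bilinear_ladd[OF bl] bilinear_lmul[OF bl] linear_add[OF lin] linear_scale[OF lin])
  moreover have "coregular p (sub_adjacent p x y) v =
      coregular p x (coregular p y v) - coregular p y (coregular p x v)" for x y v
  proof -
    have "p (sub_adjacent p x y) z = p x (p y z) - p y (p x z)" for z
    proof -
      have "p (sub_adjacent p x y) z = p (p x y) z - p (p y x) z"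
        by (simp add: sub_adjacent_def bilinear_lsub[OF bl])
      also have "\<dots> = (p (p x y) z - p x (p y z)) - p (p y x) z + p x (p y z)" by simp
      also have "\<dots> = (p (p y x) z - p y (p x z)) - p (p y x) z + p x (p y z)" by (simp only: pl)
      finally show ?thesis by simp
    qed
    then show ?thesis
      by (simp add: dual_eq_iff dual_apply_coregular[OF bl] minus_dual.rep_eq linear_diff[OF lin])
  qed
  ultimately show ?thesis by (simp add: lie_representation_def)
qed

lemma nondegenerate_iff_radical:
  fixes B :: "'a::real_vector \<Rightarrow> 'a \<Rightarrow> real"
  assumes B: "bilinear B" and fin: "finite (S :: 'a set)" "span S = UNIV"
  shows "nondegenerate B \<longleftrightarrow> (\<forall>x. (\<forall>y. B x y = 0) \<longrightarrow> x = 0)"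
proof -
  have lin: "linear (natural_map B)"
    by (auto intro!: linearI simp: dual_eq_iff dual_apply_natural_map[OF B] plus_dual.rep_eq
        scaleR_dual.rep_eq bilinear_ladd[OF B] bilinear_lmul[OF B])
  have inj: "inj (natural_map B) \<longleftrightarrow> (\<forall>x. (\<forall>y. B x y = 0) \<longrightarrow> x = 0)"
    by (simp add: linear_injective_0[OF lin] dual_eq_iff dual_apply_natural_map[OF B]
        zero_dual.rep_eq)
  obtain b where b: "b \<subseteq> S" "independent b" "span b = UNIV"
    using maximal_independent_subset[of S] fin
    by (metis span_mono span_span top.extremum_unique)
  have finb: "finite b" using b fin finite_subset by blast
  interpret fd: finite_dimensional_vector_space "scaleR :: real \<Rightarrow> 'a \<Rightarrow> 'a" b
    using b finb
    by unfold_locales (auto simp: dependent_raw_def span_raw_def algebra_simps)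
  have "surj (natural_map B)" if i: "inj (natural_map B)"
  proof
    show "UNIV \<subseteq> range (natural_map B)"
    proof
      fix f :: "'a dual"
      define T where "T x = (\<Sum>s\<in>b. B x s *\<^sub>R s)" for x
      have coeff: "u s = v s" if "(\<Sum>s\<in>b. u s *\<^sub>R s) = (\<Sum>s\<in>b. v s *\<^sub>R s)" "s \<in> b"
        for u v :: "'a \<Rightarrow> real" and s
      proof -
        have "(\<Sum>s\<in>b. (u s - v s) *\<^sub>R s) = 0"
          using that by (simp add: scaleR_left_diff_distrib sum_subtractf)
        then show ?thesis
          using independentD[OF b(2) finb subset_refl, of "\<lambda>s. u s - v s" s] that(2) by simp
      qed
      have ext_b: "g = h" if "linear g" "linear h" "\<And>s. s \<in> b \<Longrightarrow> g s = h s"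
        for g h :: "'a \<Rightarrow> real"
        using linear_eq_on_span[OF that(1,2), of b] that(3) b(3) by auto
      have linT: "linear T"
        unfolding T_def
        by (auto intro!: linearI simp: bilinear_ladd[OF B] bilinear_lmul[OF B]
            scaleR_left_distrib sum.distrib scaleR_sum_right)
      have "inj T"
      proof (rule injI)
        fix x y assume "T x = T y"
        then have "\<And>s. s \<in> b \<Longrightarrow> B x s = B y s"
          unfolding T_def using coeff by blast
        then have "B x = B y" using ext_b B by (auto simp: bilinear_def)
        then show "x = y" using i by (auto simp: natural_map_def inj_def)
      qed
      then have "surj T"
        using fd.linear_inj_imp_surj linT by (simp add: linear_def)
      then obtain x where x: "T x = (\<Sum>s\<in>b. dual_apply f s *\<^sub>R s)" by (metis surjD)
      have "B x = dual_apply f"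
        using x coeff B dual_apply[of f]
        by (intro ext_b) (auto simp: bilinear_def T_def)
      then have "natural_map B x = f" by (simp add: natural_map_def dual_apply_inverse)
      then show "f \<in> range (natural_map B)" by blast
    qed
  qed simp
  then show ?thesis using inj by (auto simp: nondegenerate_def bij_def)
qed

end

theory Submission
  imports Defs
begin

text \<open>
  Write \<open>w\<close> for the natural map of \<open>\<omega>\<close>, so that the natural map \<open>d\<^sub>i\<close> of \<open>\<B>\<^sub>i\<close> is
  \<open>w \<circ> I\<^sub>i\<close>.  Both parts are the cases \<open>e = -1\<close> and \<open>e = 1\<close> of one equivalence, with
  \<open>\<epsilon> = (e, e, -1)\<close>, and three observations carry it.

  The Hessian identity for \<open>\<B>\<close> says exactly that its natural map is a relative differential
  operator for the coregular representation, so this part of a hyper relative differential operator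
  comes for free on both sides.

  The form \<open>\<omega>\<close> cancels from the quotients \<open>d\<^sub>j\<^sup>-\<^sup>1 \<circ> d\<^sub>k\<close>: with \<open>I\<^sub>3 = I\<^sub>1 I\<^sub>2\<close> they are
  \<open>I\<^sub>2\<^sup>-\<^sup>1 I\<^sub>1\<^sup>-\<^sup>1 I\<^sub>2\<close>, \<open>I\<^sub>2\<close> and \<open>I\<^sub>2\<^sup>-\<^sup>1 I\<^sub>1\<close>.  Hence the conditions on their squares are
  equivalent to \<open>I\<^sub>1\<^sup>2 = I\<^sub>2\<^sup>2 = e\<close> and \<open>I\<^sub>1 I\<^sub>2 = - I\<^sub>2 I\<^sub>1\<close> (lemma \<open>quotient_squares_iff\<close>).

  Passing from the Hessian side to the complex side, what remains is that \<open>\<omega>\<close> is skew and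
  compatible with \<open>I\<^sub>1, I\<^sub>2\<close>, and that these are Nijenhuis.  Skewness follows from the symmetry of
  all three \<open>\<B>\<^sub>i\<close> by moving \<open>I\<^sub>1\<close> and \<open>I\<^sub>2\<close> across \<open>\<omega>\<close> in \<open>\<omega> (I\<^sub>1 I\<^sub>2 x) y\<close>; the
  anticommutation produces the sign (lemma \<open>skew_if_symmetric_twists\<close>).  The Nijenhuis identity
  holds for any quotient of two invertible relative differential operators whose square is a nonzero
  scalar (lemma \<open>nijenhuis_quotient\<close>), and \<open>I\<^sub>2 = d\<^sub>1\<^sup>-\<^sup>1 d\<^sub>3\<close>, \<open>- I\<^sub>1 = d\<^sub>2\<^sup>-\<^sup>1 d\<^sub>3\<close> are such.
\<close>

section \<open>Relative differential operators and their quotients\<close>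

text \<open>
  Rearranged, the Hessian identity reads \<open>B [x, y] z = B x (y \<cdot> z) - B y (x \<cdot> z)\<close>, whose right-hand
  side is the coregular action evaluated at \<open>z\<close>.
\<close>

lemma relative_differential_operator_natural_map:
  assumes p: "pre_lie_algebra p" and B: "hessian_structure p B"
  shows "relative_differential_operator (sub_adjacent p) (coregular p) (natural_map B)"
proof -
  have bp: "bilinear p" using p by (simp add: pre_lie_algebra_def)
  have bB: "bilinear B"
    and h: "\<And>x y z. B (p x y) z - B x (p y z) = B (p y x) z - B y (p x z)"
    using B by (auto simp: hessian_structure_def)
  have "linear (natural_map B)"
    by (auto intro!: linearI simp: dual_eq_iff dual_apply_natural_map[OF bB] plus_dual.rep_eq
        scaleR_dual.rep_eq bilinear_ladd[OF bB] bilinear_lmul[OF bB])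
  moreover have "natural_map B (sub_adjacent p x y) =
      coregular p x (natural_map B y) - coregular p y (natural_map B x)" for x y
  proof -
    have "B (p x y - p y x) z = B x (p y z) - B y (p x z)" for z
      using h[of x y z] by (simp add: bilinear_lsub[OF bB])
    then show ?thesis
      by (simp add: dual_eq_iff dual_apply_natural_map[OF bB] dual_apply_coregular[OF bp]
          minus_dual.rep_eq sub_adjacent_def)
  qed
  ultimately show ?thesis
    by (simp add: relative_differential_operator_def lie_algebra_sub_adjacent[OF p]
        lie_representation_coregular[OF p])
qed

text \<open>
  Here \<open>N\<close> is the quotient \<open>d\<^sup>-\<^sup>1 \<circ> d'\<close> of the relative differential operators \<open>d\<close> and
  \<open>d' = d \<circ> N\<close>.  The deformed bracket \<open>[N x, y] + [x, N y] - N [x, y]\<close> is mapped by \<open>d\<close> to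
  \<open>\<rho> (N x) (d y) - \<rho> (N y) (d x)\<close>, and since \<open>d' \<circ> N = c d\<close>, the operator \<open>d'\<close> maps
  \<open>[N x, N y]\<close> to \<open>c\<close> times the same element.  So \<open>N [N x, N y]\<close> is \<open>c\<close> times the deformed bracket,
  and one more application of \<open>N\<close> gives the Nijenhuis identity.
\<close>

lemma nijenhuis_quotient:
  assumes d: "relative_differential_operator br \<rho> d" and inj: "inj d"
    and d': "relative_differential_operator br \<rho> (\<lambda>x. d (N x))"
    and N: "linear N" and NN: "\<And>x. N (N x) = c *\<^sub>R x" and c: "c \<noteq> 0"
  shows "nijenhuis br N"
proof -
  have lin: "linear d" and bl: "bilinear \<rho>"
    and D: "\<And>x y. d (br x y) = \<rho> x (d y) - \<rho> y (d x)"
    using d by (auto simp: relative_differential_operator_def lie_representation_def)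
  have D': "\<And>x y. d (N (br x y)) = \<rho> x (d (N y)) - \<rho> y (d (N x))"
    using d' by (auto simp: relative_differential_operator_def)
  have "br (N x) (N y) = N (br (N x) y + br x (N y) - N (br x y))" (is "_ = N ?s") for x y
  proof -
    have s: "d ?s = \<rho> (N x) (d y) - \<rho> (N y) (d x)"
      by (simp add: linear_add[OF lin] linear_diff[OF lin] D D')
    have "d (N (br (N x) (N y))) = c *\<^sub>R (\<rho> (N x) (d y) - \<rho> (N y) (d x))"
      by (simp add: D' NN linear_scale[OF lin] bilinear_rmul[OF bl] scaleR_diff_right)
    also have "\<dots> = d (c *\<^sub>R ?s)"
      by (simp only: s linear_scale[OF lin])
    finally have "N (br (N x) (N y)) = c *\<^sub>R ?s"
      using inj by (simp only: inj_eq)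
    then have "N (N (br (N x) (N y))) = N (c *\<^sub>R ?s)" by (simp only:)
    then have "c *\<^sub>R br (N x) (N y) = c *\<^sub>R N ?s"
      by (simp only: NN linear_scale[OF N])
    then show ?thesis using c by simp
  qed
  then show ?thesis using N by (simp add: nijenhuis_def)
qed

lemma nijenhuis_uminus:
  assumes br: "bilinear br" and N: "nijenhuis br (\<lambda>x. - N x)"
  shows "nijenhuis br N"
proof -
  have "linear N"
    using N linear_compose_neg[of "\<lambda>x. - N x"] by (simp add: nijenhuis_def)
  moreover have "br (N x) (N y) = N (br (N x) y + br x (N y) - N (br x y))" (is "_ = N ?s") for x y
  proof -
    have "br (- N x) (- N y) = - N (br (- N x) y + br x (- N y) - - N (br x y))"
      using N unfolding nijenhuis_def by blast
    moreover have "br (- N x) y + br x (- N y) - - N (br x y) = - ?s"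
      by (simp add: bilinear_lneg[OF br] bilinear_rneg[OF br])
    ultimately have "br (N x) (N y) = - N (- ?s)"
      by (simp only: bilinear_lneg[OF br] bilinear_rneg[OF br] minus_minus)
    then show ?thesis by (simp only: linear_neg[OF \<open>linear N\<close>] minus_minus)
  qed
  ultimately show ?thesis by (simp add: nijenhuis_def)
qed

section \<open>Skewness of the underlying form\<close>

text \<open>
  Expanding \<open>\<omega> (I1 (I2 x)) y\<close> by the symmetry of the first and third twist gives
  \<open>\<omega> (I1 x) (I2 y)\<close>; anticommuting first and using the second twist gives \<open>- \<omega> (I2 y) (I1 x)\<close>.
\<close>

lemma skew_if_symmetric_twists:
  fixes \<omega> :: "'a::real_vector \<Rightarrow> 'a \<Rightarrow> real"
  assumes \<omega>: "bilinear \<omega>"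
    and s1: "\<And>x y. \<omega> (I1 x) y = \<omega> (I1 y) x"
    and s2: "\<And>x y. \<omega> (I2 x) y = \<omega> (I2 y) x"
    and s3: "\<And>x y. \<omega> (I1 (I2 x)) y = \<omega> (I1 (I2 y)) x"
    and anti: "\<And>x. I1 (I2 x) = - I2 (I1 x)"
    and surj: "surj I1" "surj I2"
  shows "\<omega> x y = - \<omega> y x"
proof -
  obtain u v where uv: "x = I1 u" "y = I2 v" using surj by (meson surjD)
  have "\<omega> (I1 u) (I2 v) = \<omega> (I1 (I2 u)) v" using s1 s3 by metis
  also have "\<dots> = - \<omega> (I2 (I1 u)) v" by (simp add: anti bilinear_lneg[OF \<omega>])
  also have "\<dots> = - \<omega> (I2 v) (I1 u)" using s2 by metis
  finally show ?thesis by (simp add: uv)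
qed

section \<open>Operator equations from the quotients\<close>

lemma quotient_square:
  assumes "bij f" and "\<And>x. f (J x) = g x"
  shows "((inv f \<circ> g) ^^ 2) x = J (J x)"
proof -
  have "inv f (g z) = J z" for z
    using assms by (metis bij_is_inj inv_f_f)
  then show ?thesis by (simp add: numeral_2_eq_2)
qed

text \<open>
  The common factor \<open>w\<close> cancels from each quotient.  The second quotient is \<open>I2\<close>, and the first
  is \<open>I2\<^sup>-\<^sup>1 I1\<^sup>-\<^sup>1 I2\<close>, conjugate to the inverse of \<open>I1\<close>; so both squares are \<open>e\<close>.  The third is
  \<open>I2\<^sup>-\<^sup>1 I1 = e I2 I1\<close>, and since \<open>e\<^sup>2 = 1\<close>, its square being \<open>- 1\<close> means
  \<open>(I2 I1)\<^sup>2 = - 1\<close>, that is, anticommutation.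
\<close>

lemma quotient_squares_iff:
  fixes w :: "'a::real_vector \<Rightarrow> 'v" and e :: real
  assumes lin: "linear I1" "linear I2" and e: "e \<in> {1, -1}"
    and b: "bij (\<lambda>x. w (I1 x))" "bij (\<lambda>x. w (I2 x))" "bij (\<lambda>x. w (I1 (I2 x)))"
  shows "(\<forall>x. ((inv (\<lambda>x. w (I1 (I2 x))) \<circ> (\<lambda>x. w (I2 x))) ^^ 2) x = e *\<^sub>R x) \<and>
         (\<forall>x. ((inv (\<lambda>x. w (I1 x)) \<circ> (\<lambda>x. w (I1 (I2 x)))) ^^ 2) x = e *\<^sub>R x) \<and>
         (\<forall>x. ((inv (\<lambda>x. w (I2 x)) \<circ> (\<lambda>x. w (I1 x))) ^^ 2) x = (- 1) *\<^sub>R x) \<longleftrightarrow>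
         (\<forall>x. I1 (I1 x) = e *\<^sub>R x) \<and> (\<forall>x. I2 (I2 x) = e *\<^sub>R x) \<and>
         (\<forall>x. I1 (I2 x) = - I2 (I1 x))"
    (is "?q1 \<and> ?q2 \<and> ?q3 \<longleftrightarrow> ?s1 \<and> ?s2 \<and> ?a")
proof -
  have ee: "e * e = 1" using e by auto
  note ls = linear_scale[OF lin(1)] linear_scale[OF lin(2)]
  note ln = linear_neg[OF lin(1)] linear_neg[OF lin(2)]
  have q2: "((inv (\<lambda>x. w (I1 x)) \<circ> (\<lambda>x. w (I1 (I2 x)))) ^^ 2) x = I2 (I2 x)" for x
    by (rule quotient_square[OF b(1)]) simp
  show ?thesis
  proof
    assume R: "?s1 \<and> ?s2 \<and> ?a"
    then have s1: "\<And>x. I1 (I1 x) = e *\<^sub>R x" and s2: "\<And>x. I2 (I2 x) = e *\<^sub>R x"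
      and a: "\<And>x. I2 (I1 x) = - I1 (I2 x)" by auto
    have "((inv (\<lambda>x. w (I1 (I2 x))) \<circ> (\<lambda>x. w (I2 x))) ^^ 2) x = e *\<^sub>R x" for x
    proof -
      \<comment> \<open>anticommutation turns the conjugate of \<open>I1\<^sup>-\<^sup>1 = e I1\<close> by \<open>I2\<close> into \<open>- e I1\<close>\<close>
      have "((inv (\<lambda>x. w (I1 (I2 x))) \<circ> (\<lambda>x. w (I2 x))) ^^ 2) x =
          - e *\<^sub>R I1 (- e *\<^sub>R I1 x)"
        by (rule quotient_square[OF b(3), where J = "\<lambda>x. - e *\<^sub>R I1 x"])
          (simp add: ls ln a s1 ee)
      then show ?thesis by (simp add: ls ln s1 ee)
    qed
    moreover have "((inv (\<lambda>x. w (I2 x)) \<circ> (\<lambda>x. w (I1 x))) ^^ 2) x = (- 1) *\<^sub>R x" for x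
    proof -
      have "((inv (\<lambda>x. w (I2 x)) \<circ> (\<lambda>x. w (I1 x))) ^^ 2) x =
          e *\<^sub>R I2 (I1 (e *\<^sub>R I2 (I1 x)))"
        by (rule quotient_square[OF b(2), where J = "\<lambda>x. e *\<^sub>R I2 (I1 x)"])
          (simp add: ls s2 ee)
      then show ?thesis by (simp add: ls ln a s1 s2 ee)
    qed
    ultimately show "?q1 \<and> ?q2 \<and> ?q3" using q2 s2 by simp
  next
    assume L: "?q1 \<and> ?q2 \<and> ?q3"
    then have s2: "\<And>x. I2 (I2 x) = e *\<^sub>R x" by (simp add: q2)
    have e2: "e *\<^sub>R I2 (I2 x) = x" for x by (simp add: s2 ee)
    define J where "J x = inv (\<lambda>x. w (I1 (I2 x))) (w (I2 x))" for x
    have J: "w (I1 (I2 (J x))) = w (I2 x)" for x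
      unfolding J_def by (rule surj_f_inv_f[OF bij_is_surj[OF b(3)]])
    \<comment> \<open>\<open>I2\<close> is onto, so injectivity of \<open>w \<circ> I2\<close> passes to \<open>w\<close>\<close>
    have wI: "inj w"
    proof (rule injI)
      fix x y assume "w x = w y"
      then have "w (I2 (e *\<^sub>R I2 x)) = w (I2 (e *\<^sub>R I2 y))" by (simp add: ls e2)
      then have "e *\<^sub>R I2 x = e *\<^sub>R I2 y" using b(2) by (meson bij_is_inj injD)
      then have "I2 (e *\<^sub>R I2 x) = I2 (e *\<^sub>R I2 y)" by (simp only:)
      then show "x = y" by (simp add: ls e2)
    qed
    have J1: "I1 (I2 (J x)) = I2 x" for x using J wI by (meson injD)
    have JJ: "J (J x) = e *\<^sub>R x" for x
      using L quotient_square[of "\<lambda>x. w (I1 (I2 x))" J "\<lambda>x. w (I2 x)" x, OF b(3) J] by simp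
    have s1: "I1 (I1 x) = e *\<^sub>R x" for x
    proof -
      \<comment> \<open>the preimage of \<open>x\<close> under \<open>I2\<close>\<close>
      let ?u = "e *\<^sub>R I2 x"
      have "I1 (I1 (I2 (J (J ?u)))) = I2 ?u" by (simp only: J1)
      then have "e *\<^sub>R I1 (I1 x) = x" by (simp add: JJ ls s2 ee)
      then have "e *\<^sub>R e *\<^sub>R I1 (I1 x) = e *\<^sub>R x" by (simp only:)
      then show ?thesis by (simp add: ee)
    qed
    have "((inv (\<lambda>x. w (I2 x)) \<circ> (\<lambda>x. w (I1 x))) ^^ 2) x =
        e *\<^sub>R I2 (I1 (e *\<^sub>R I2 (I1 x)))" for x
      by (rule quotient_square[OF b(2), where J = "\<lambda>x. e *\<^sub>R I2 (I1 x)"])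
        (simp add: ls s2 ee)
    then have a: "I2 (I1 (I2 (I1 x))) = - x" for x
      using L by (simp add: ls ee)
    have "I1 (I2 x) = - I2 (I1 x)" for x
    proof -
      \<comment> \<open>the word \<open>I1 I2 I2 I1 I2 I1\<close> read as \<open>I1 I2 (I2 I1)\<^sup>2\<close> and as \<open>I1 (I2 I2) I1 (I2 I1)\<close>\<close>
      have "I1 (I2 (I2 (I1 (I2 (I1 x))))) = - I1 (I2 x)"
        by (simp add: a ln)
      moreover have "I1 (I2 (I2 (I1 (I2 (I1 x))))) = I2 (I1 x)"
        by (simp add: ls s1 s2 ee)
      ultimately show ?thesis by simp
    qed
    then show "?s1 \<and> ?s2 \<and> ?a" using s1 s2 by simp
  qed
qed

section \<open>Hyper Hessian structures and anti-commuting operators\<close>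

text \<open>
  Both sides contain the Hessian identities.  Granting these, the left side amounts to the operator
  equations for \<open>I1\<close> and \<open>I2\<close> alone, because the natural maps are then automatically invertible
  relative differential operators.  Everything else on the right side is a consequence: \<open>\<omega>\<close> is
  nondegenerate since \<open>w = (w \<circ> I2) \<circ> (e I2)\<close>, and the compatibility of
  \<open>\<omega>\<close> with \<open>I\<^sub>i\<close> combines the symmetry of \<open>\<B>\<^sub>i\<close>, the equation \<open>I\<^sub>i\<^sup>2 = e\<close> and skewness.
\<close>

lemma hyper_hessian_structure_iff:
  fixes p :: "'a::real_vector \<Rightarrow> 'a \<Rightarrow> 'a" and \<omega> :: "'a \<Rightarrow> 'a \<Rightarrow> real" and e :: real
  assumes p: "pre_lie_algebra p" and \<omega>: "bilinear \<omega>"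
    and lin: "linear I1" "linear I2" and e: "e \<in> {1, -1}"
  shows "hyper_hessian_structure p (e, e, -1)
           (\<lambda>x y. \<omega> (I1 x) y) (\<lambda>x y. \<omega> (I2 x) y) (\<lambda>x y. \<omega> (I1 (I2 x)) y) \<longleftrightarrow>
         nondegenerate \<omega> \<and> (\<forall>x y. \<omega> x y = - \<omega> y x) \<and>
         (\<forall>I \<in> {I1, I2}. nijenhuis (sub_adjacent p) I \<and> (\<forall>x. I (I x) = e *\<^sub>R x) \<and>
            (\<forall>x y. \<omega> (I x) (I y) = - e * \<omega> x y)) \<and>
         (\<forall>x. I1 (I2 x) = - I2 (I1 x)) \<and>
         (\<forall>I \<in> {I1, I2, I1 \<circ> I2}. hessian_structure p (\<lambda>x y. \<omega> (I x) y))"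
    (is "?L \<longleftrightarrow> ?R")
proof (cases "\<forall>I \<in> {I1, I2, I1 \<circ> I2}. hessian_structure p (\<lambda>x y. \<omega> (I x) y)")
  case False
  then show ?thesis by (auto simp: hyper_hessian_structure_def o_def)
next
  case True
  let ?w = "natural_map \<omega>" and ?br = "sub_adjacent p" and ?\<rho> = "coregular p"
  have nat: "natural_map (\<lambda>x y. \<omega> (I1 x) y) = (\<lambda>x. ?w (I1 x))"
    "natural_map (\<lambda>x y. \<omega> (I2 x) y) = (\<lambda>x. ?w (I2 x))"
    "natural_map (\<lambda>x y. \<omega> (I1 (I2 x)) y) = (\<lambda>x. ?w (I1 (I2 x)))"
    by (simp_all add: natural_map_def fun_eq_iff)
  have h: "hessian_structure p (\<lambda>x y. \<omega> (I1 x) y)" "hessian_structure p (\<lambda>x y. \<omega> (I2 x) y)"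
    "hessian_structure p (\<lambda>x y. \<omega> (I1 (I2 x)) y)"
    using True by (auto simp: o_def)
  have b: "bij (\<lambda>x. ?w (I1 x))" "bij (\<lambda>x. ?w (I2 x))" "bij (\<lambda>x. ?w (I1 (I2 x)))"
    unfolding nat[symmetric]
    using h[unfolded hessian_structure_def nondegenerate_def] by blast+
  have rdo: "relative_differential_operator ?br ?\<rho> (\<lambda>x. ?w (I1 x))"
    "relative_differential_operator ?br ?\<rho> (\<lambda>x. ?w (I2 x))"
    "relative_differential_operator ?br ?\<rho> (\<lambda>x. ?w (I1 (I2 x)))"
    using h[THEN relative_differential_operator_natural_map[OF p]] by (simp_all add: nat)
  have L: "?L \<longleftrightarrow> (\<forall>x. I1 (I1 x) = e *\<^sub>R x) \<and> (\<forall>x. I2 (I2 x) = e *\<^sub>R x) \<and>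
      (\<forall>x. I1 (I2 x) = - I2 (I1 x))"
    using quotient_squares_iff[OF lin e b] h e rdo b
    by (simp add: hyper_hessian_structure_def hyper_relative_differential_operator_def nat)
  show ?thesis
  proof
    assume ?R
    then show ?L unfolding L by blast
  next
    assume ?L
    then have s1: "\<And>x. I1 (I1 x) = e *\<^sub>R x" and s2: "\<And>x. I2 (I2 x) = e *\<^sub>R x"
      and a: "\<And>x. I1 (I2 x) = - I2 (I1 x)" unfolding L by blast+
    have ee: "e * e = 1" and e0: "e \<noteq> 0" using e by auto
    have r: "I1 (e *\<^sub>R I1 x) = x" "I2 (e *\<^sub>R I2 x) = x" for x
      by (simp_all add: linear_scale[OF lin(1)] linear_scale[OF lin(2)] s1 s2 ee)
    have surj: "surj I1" "surj I2"
      using surjI[of I1 "\<lambda>x. e *\<^sub>R I1 x"] surjI[of I2 "\<lambda>x. e *\<^sub>R I2 x"] r by blast+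
    have sym: "\<omega> (I1 x) y = \<omega> (I1 y) x" "\<omega> (I2 x) y = \<omega> (I2 y) x"
      "\<omega> (I1 (I2 x)) y = \<omega> (I1 (I2 y)) x" for x y
      using h unfolding hessian_structure_def by blast+
    have skew: "\<omega> x y = - \<omega> y x" for x y
      by (rule skew_if_symmetric_twists[OF \<omega> sym a surj])
    have "bij (\<lambda>x. e *\<^sub>R I2 x)"
      by (rule o_bij[of I2]) (simp_all add: fun_eq_iff r(2) s2 ee)
    then have "bij (\<lambda>x. ?w (I2 (e *\<^sub>R I2 x)))"
      using bij_comp[OF _ b(2), of "\<lambda>x. e *\<^sub>R I2 x"] by (simp add: o_def)
    then have nd: "nondegenerate \<omega>"
      by (simp add: nondegenerate_def r(2))
    have compat: "\<omega> (I x) (I y) = - e * \<omega> x y" if "I \<in> {I1, I2}" for I x y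
    proof -
      have "\<omega> (I x) (I y) = \<omega> (I (I y)) x" using that sym by blast
      also have "\<dots> = \<omega> (e *\<^sub>R y) x" using that s1 s2 by auto
      also have "\<dots> = - e * \<omega> x y" using skew[of y x] by (simp add: bilinear_lmul[OF \<omega>])
      finally show ?thesis .
    qed
    have "nijenhuis ?br I2"
      by (rule nijenhuis_quotient[OF rdo(1) bij_is_inj[OF b(1)] rdo(3) lin(2) s2 e0])
    \<comment> \<open>\<open>- I1\<close> rather than \<open>I1\<close>, since \<open>d\<^sub>2 \<circ> (- I1) = d\<^sub>3\<close> by anticommutation\<close>
    moreover have "nijenhuis ?br (\<lambda>x. - I1 x)"
    proof (rule nijenhuis_quotient[OF rdo(2) bij_is_inj[OF b(2)] _ linear_compose_neg[OF lin(1)] _ e0])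
      show "relative_differential_operator ?br ?\<rho> (\<lambda>x. ?w (I2 (- I1 x)))"
        using rdo(3) by (simp add: a linear_neg[OF lin(2)])
      show "- I1 (- I1 x) = e *\<^sub>R x" for x by (simp add: linear_neg[OF lin(1)] s1)
    qed
    then have "nijenhuis ?br I1"
      using nijenhuis_uminus lie_algebra_sub_adjacent[OF p] by (auto simp: lie_algebra_def)
    ultimately show ?R using nd skew compat s1 s2 a True by blast
  qed
qed

theorem proposition5p13:
  fixes p :: "'a::real_vector \<Rightarrow> 'a \<Rightarrow> 'a"
    and \<omega> :: "'a \<Rightarrow> 'a \<Rightarrow> real"
    and I1 I2 I3 :: "'a \<Rightarrow> 'a"
  assumes "pre_lie_algebra p"
    and "bilinear \<omega>"
    and "linear I1" "linear I2" "linear I3"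
    and "I3 = I1 \<circ> I2"
  shows "(hyper_anti_kaehler p \<omega> I1 I2 I3 \<longleftrightarrow>
            hyper_hessian_structure p (-1, -1, -1)
              (\<lambda>x y. \<omega> (I1 x) y) (\<lambda>x y. \<omega> (I2 x) y) (\<lambda>x y. \<omega> (I3 x) y)) \<and>
         (para_hyper_anti_kaehler p \<omega> I1 I2 I3 \<longleftrightarrow>
            hyper_hessian_structure p (1, 1, -1)
              (\<lambda>x y. \<omega> (I1 x) y) (\<lambda>x y. \<omega> (I2 x) y) (\<lambda>x y. \<omega> (I3 x) y))"
proof -
  note iff = hyper_hessian_structure_iff[OF assms(1-4)]
  have "hyper_anti_kaehler p \<omega> I1 I2 (I1 \<circ> I2) \<longleftrightarrow>
      hyper_hessian_structure p (-1, -1, -1)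
        (\<lambda>x y. \<omega> (I1 x) y) (\<lambda>x y. \<omega> (I2 x) y) (\<lambda>x y. \<omega> (I1 (I2 x)) y)"
    unfolding iff[of "-1", OF insertI2[OF insertI1]] scaleR_minus1_left minus_minus mult_1
      hyper_anti_kaehler_def anti_hermitian_def complex_structure_def
    using assms(2) by blast
  moreover have "para_hyper_anti_kaehler p \<omega> I1 I2 (I1 \<circ> I2) \<longleftrightarrow>
      hyper_hessian_structure p (1, 1, -1)
        (\<lambda>x y. \<omega> (I1 x) y) (\<lambda>x y. \<omega> (I2 x) y) (\<lambda>x y. \<omega> (I1 (I2 x)) y)"
    unfolding iff[of 1, OF insertI1] scaleR_one mult_minus1
      para_hyper_anti_kaehler_def para_anti_hermitian_def para_complex_structure_def
    using assms(2) by blast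
  ultimately show ?thesis by (simp add: assms(6))
qed

end
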